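(* Let $F:\mathbb{R}^d\to\mathbb{R}$ be continuously differentiable and bounded from below, with $\|\nabla F(x)-\nabla F(y)\|\le L\|x-y\|$ for all $x,y\in\mathbb{R}^d$, where $L>0$. Let the random vectors $(\theta_n,w_n,z_n,y_n)_{n\ge1}$ be generated from given initial data $(\theta_1,w_1)$, with $\mathbb{E}[F(w_1)]<+\infty$, by $$z_n=(1-\tilde\gamma_n)\odot\theta_n+\tilde\gamma_n\odot w_n,\quad y_n=(1-\mu_n)\theta_n+\mu_n w_n,\quad w_{n+1}=w_n-\lambda_n\odot g_n,\quad \theta_{n+1}=y_n-\alpha_n\odot g_n\qquad(n\ge1),$$ where $\mu_1=1$ and $\mu_n\in(0,1)$ for $n\ge2$ are real numbers, $\tilde\gamma_n\in\mathbb{R}^d$ are (possibly random) positive vectors forming a bounded sequence with $\tilde\gamma_1=\mathbf 1$, and $(\lambda_n)$, $(\alpha_n)$ are (possibly random) positive stepsize vectors in $\mathbb{R}^d$ which are almost surely bounded (by a deterministic constant). Let $B$ be a constant such that $\frac{\|1-\tilde\gamma_n\|^2}{1-\mu_n}\le B$ almost surely for all $n\ge2$. Write $\delta_n=g_n-\nabla F(z_n)$. Let $(\mathcal{F}_n)_{n\ge1}$ be an increasing sequence of $\sigma$-fields such that, for all $n\ge1$: $w_n,z_n,\lambda_n,\alpha_n$ are $\mathcal{F}_n$-measurable, $\mathbb{E}[g_n\mid\mathcal{F}_n]=\nabla F(z_n)$, and $\mathbb{E}[\|\delta_n\|^2\mid\mathcal{F}_n]\le\sigma^2$ almost surely, for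 some $\sigma>0$. Let $\Gamma_1=1$, $\Gamma_n=(1-\mu_n)\Gamma_{n-1}$ for $n\ge2$, and $C_{n,N}=\sum_{j=n}^N\Gamma_j$ for $1\le n\le N$. Assume that $(\Gamma_n)$ is bounded and that $C_{n,N}$ admits a strictly positive upper bound (possibly depending on $N$). Assume there are deterministic numbers $m_n>0$ (not depending on $N$) and $R_{n,N}>0$ such that, for all $1\le n\le N$, almost surely, $$\lambda_n-L[\lambda_n]^2-\frac{LB}{2}\frac{C_{n,N}}{\mu_n\Gamma_n}[\lambda_n-\alpha_n]^2\ge m_n\ \text{ (componentwise)},\qquad \|\lambda_n\|^2+B\frac{C_{n,N}}{\mu_n\Gamma_n}\|\lambda_n-\alpha_n\|^2\le R_{n,N},$$ and that $\sigma^2\lim_{N\to\infty}\sum_{n=1}^{N}R_{n,N}<+\infty$. If in addition $$\sum_{n=1}^{+\infty}m_n=+\infty,$$ then $\liminf_{n\to+\infty}\|\nabla F(z_n)\|=0$ almost surely.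
   Context: All norms are Euclidean norms on $\mathbb{R}^d$. $u\odot v$ is the componentwise (Hadamard) product, $[u]^2=u\odot u$; for a scalar $\rho$ and a vector $u$, expressions such as $\rho-u$ are taken componentwise, and $u\ge\rho$ means that every component of $u$ is $\ge\rho$. A vector is positive if all its components are positive; $\mathbf 1=(1,\dots,1)$. The random vector $g_n$ is a noisy (stochastic) evaluation of the gradient $\nabla F$ at the point $z_n$, and $\delta_n$ is its noise. *)

theory Defs
  imports "HOL-Probability.Probability"
begin

(* On the type real ^ 'd the library's arithmetic is componentwise: u * v is the Hadamard product,
   u^2 = u * u, 1 is the all-ones vector, and u \<le> v means that every component of u is at most the
   corresponding component of v.  The strict order on real ^ 'd is not the componentwise one. *)

definition pos_vec :: "real ^ 'd \<Rightarrow> bool" where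
  "pos_vec u \<longleftrightarrow> (\<forall>i. 0 < u $ i)"

(* The conditional expectation of the library is scalar.  As with real_cond_exp, this is the usual
   conditional expectation when X is integrable. *)
definition vec_cond_exp :: "'a measure \<Rightarrow> 'a measure \<Rightarrow> ('a \<Rightarrow> real ^ 'd) \<Rightarrow> 'a \<Rightarrow> real ^ 'd" where
  "vec_cond_exp M G X = (\<lambda>\<omega>. \<chi> i. real_cond_exp M G (\<lambda>\<omega>'. X \<omega>' $ i) \<omega>)"

end

theory Submission
  imports Defs
begin

text \<open>Fix a horizon \<open>N\<close>. Since \<open>w (n + 1) = w n - lam n * g n\<close> and \<open>g n\<close> estimates the gradient at \<open>z n\<close>
  rather than at \<open>w n\<close>, the descent lemma makes \<open>F (w n)\<close> decrease up to an error of the order of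
  \<open>(norm (w n - z n))\<^sup>2\<close>. This lag is controlled by the velocity \<open>D n = w n - \<theta> n\<close>, which obeys the
  contraction \<open>D (n + 1) = (1 - \<mu> n) D n - (lam n - \<alpha> n) * g n\<close>; by convexity its square
  is at most \<open>\<Gamma> n\<close> times a sum over the past steps (\<open>velocity_bound\<close>). Exchanging the two
  summations produces the constants \<open>C n N\<close>, and the two conditions on the step sizes are precisely
  what turns the resulting estimate into the pathwise bound (\<open>energy_inequality\<close>)

  \<open>F (w (N + 1)) + (\<Sum>n=1..N. m n * (norm (gradF (z n)))\<^sup>2)
    \<le> F (w 1) + L / 2 * (\<Sum>n=1..N. R n N * (norm (\<delta> n))\<^sup>2) + (\<Sum>n=1..N. V n N \<bullet> \<delta> n)\<close>

  with vectors \<open>V n N\<close> known at time \<open>n\<close>. In expectation the last sum vanishes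
  (\<open>expectation_inner_unbiased_noise\<close>) and the noise energy before it is at most \<open>L / 2 * \<sigma>\<^sup>2\<close> times the sum
  of the \<open>R n N\<close>, which stays bounded. As \<open>F\<close> is bounded below, the expectations of
  \<open>\<Sum>n=1..N. m n * (norm (gradF (z n)))\<^sup>2\<close> are bounded in \<open>N\<close>. By monotone convergence these
  sums are almost surely bounded (\<open>AE_bounded_partial_sums\<close>), and as the weights \<open>m n\<close> have a
  divergent sum, the gradient norms cannot stay away from \<open>0\<close>.

  Taking expectations requires square integrable gradients. This is propagated along the iteration
  from the integrability of \<open>F (w 1)\<close>, because a function with Lipschitz gradient that is bounded
  below dominates the square of its gradient (\<open>Lipschitz_gradient_norm_bound\<close>).\<close>

section \<open>Functions with Lipschitz gradient\<close>

lemma GDERIV_imp_continuous_on: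
  fixes F :: "'b::real_inner \<Rightarrow> real"
  assumes "\<And>x. GDERIV F x :> gradF x"
  shows "continuous_on UNIV F"
  using assms unfolding gderiv_def
  by (meson continuous_at_imp_continuous_on has_derivative_continuous)

text \<open>Along the segment from \<open>x\<close> to \<open>x + d\<close>, subtracting the right-hand side from \<open>F\<close> leaves a function
  of one real variable whose derivative the Lipschitz condition keeps nonpositive.\<close>
lemma Lipschitz_gradient_descent:
  fixes F :: "'b::real_inner \<Rightarrow> real"
  assumes grad: "\<And>x. GDERIV F x :> gradF x"
    and Lip: "\<And>x y. norm (gradF x - gradF y) \<le> L * norm (x - y)"
  shows "F (x + d) \<le> F x + gradF x \<bullet> d + L / 2 * (norm d)\<^sup>2"
proof -
  define \<phi> where "\<phi> t = F (x + t *\<^sub>R d) - t * (gradF x \<bullet> d) - L / 2 * t\<^sup>2 * (norm d)\<^sup>2" for t :: real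
  have "\<phi> 0 \<ge> \<phi> 1"
  proof (rule DERIV_nonpos_imp_nonincreasing[where f = \<phi>])
    fix t :: real assume t: "0 \<le> t" "t \<le> 1"
    have "((\<lambda>t. F (x + t *\<^sub>R d)) has_derivative (\<lambda>h. (h *\<^sub>R d) \<bullet> gradF (x + t *\<^sub>R d))) (at t)"
      by (rule has_derivative_compose[where g = F])
         (auto intro!: derivative_eq_intros grad[unfolded gderiv_def])
    then have "((\<lambda>t. F (x + t *\<^sub>R d)) has_field_derivative gradF (x + t *\<^sub>R d) \<bullet> d) (at t)"
      unfolding has_field_derivative_def
      by (rule has_derivative_eq_rhs) (simp add: inner_commute fun_eq_iff)
    then have "DERIV \<phi> t :> gradF (x + t *\<^sub>R d) \<bullet> d - gradF x \<bullet> d - L * t * (norm d)\<^sup>2"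
      unfolding \<phi>_def by (auto intro!: derivative_eq_intros simp: field_simps)
    moreover have "gradF (x + t *\<^sub>R d) \<bullet> d - gradF x \<bullet> d \<le> L * t * (norm d)\<^sup>2"
    proof -
      have "gradF (x + t *\<^sub>R d) \<bullet> d - gradF x \<bullet> d \<le> norm (gradF (x + t *\<^sub>R d) - gradF x) * norm d"
        by (metis inner_diff_left norm_cauchy_schwarz)
      also have "\<dots> \<le> (L * norm (t *\<^sub>R d)) * norm d"
        using Lip[of "x + t *\<^sub>R d" x] by (intro mult_right_mono) auto
      finally show ?thesis using t by (simp add: power2_eq_square mult.assoc)
    qed
    ultimately show "\<exists>y. DERIV \<phi> t :> y \<and> y \<le> 0" by force
  qed simp
  then show ?thesis by (simp add: \<phi>_def)
qed

text \<open>A gradient step of length \<open>1 / L\<close> decreases \<open>F\<close> by at least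
  \<open>(norm (gradF x))\<^sup>2 / (2 * L)\<close>, and it cannot lead below the lower bound \<open>l\<close>.\<close>
lemma Lipschitz_gradient_norm_bound:
  fixes F :: "'b::real_inner \<Rightarrow> real"
  assumes grad: "\<And>x. GDERIV F x :> gradF x"
    and Lip: "\<And>x y. norm (gradF x - gradF y) \<le> L * norm (x - y)"
    and "L > 0" and lb: "\<And>x. l \<le> F x"
  shows "(norm (gradF x))\<^sup>2 \<le> 2 * L * (F x - l)"
proof -
  define d where "d = (- 1 / L) *\<^sub>R gradF x"
  have "gradF x \<bullet> d = - ((norm (gradF x))\<^sup>2 / L)"
    by (simp add: d_def power2_norm_eq_inner)
  moreover have "L / 2 * (norm d)\<^sup>2 = (norm (gradF x))\<^sup>2 / (2 * L)"
    using \<open>L > 0\<close> by (simp add: d_def power_divide power2_eq_square)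
  moreover have "l \<le> F x + gradF x \<bullet> d + L / 2 * (norm d)\<^sup>2"
    using lb[of "x + d"] Lipschitz_gradient_descent[OF grad Lip, of x d] by linarith
  ultimately have "l \<le> F x - (norm (gradF x))\<^sup>2 / (2 * L)"
    by (simp add: field_simps)
  then show ?thesis using \<open>L > 0\<close> by (simp add: field_simps)
qed

section \<open>The Hadamard product\<close>

lemma norm_hadamard_le:
  fixes u v :: "real ^ 'd"
  shows "norm (u * v) \<le> norm u * norm v"
proof (rule power2_le_imp_le)
  have "(norm (u * v))\<^sup>2 = (\<Sum>i\<in>UNIV. (u $ i)\<^sup>2 * (v $ i)\<^sup>2)"
    unfolding power2_norm_eq_inner inner_vec_def by (simp add: power2_eq_square algebra_simps)
  also have "\<dots> \<le> (\<Sum>i\<in>UNIV. (norm u)\<^sup>2 * (v $ i)\<^sup>2)"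
    by (intro sum_mono mult_right_mono) (auto simp: component_le_norm_cart power2_le_iff_abs_le)
  also have "\<dots> = (norm u * norm v)\<^sup>2"
    unfolding sum_distrib_left[symmetric] power_mult_distrib power2_norm_eq_inner inner_vec_def
    by (simp add: power2_eq_square)
  finally show "(norm (u * v))\<^sup>2 \<le> (norm u * norm v)\<^sup>2" .
qed simp

lemma inner_hadamard: "(u * a) \<bullet> b = a \<bullet> (u * (b :: real ^ 'd))"
  by (simp add: inner_vec_def algebra_simps)

lemma scaleR_hadamard: "(c *\<^sub>R u) * a = c *\<^sub>R (u * (a :: real ^ 'd))"
  by (simp add: vec_eq_iff)

text \<open>The mixed term is written as a vector paired with \<open>b\<close> alone: when \<open>b\<close> is conditionally centred
  noise and \<open>u\<close>, \<open>a\<close> are known beforehand, its expectation vanishes.\<close>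
lemma hadamard_norm_add:
  fixes u a b :: "real ^ 'd"
  shows "(norm (u * (a + b)))\<^sup>2 = (norm (u * a))\<^sup>2 + 2 * ((u\<^sup>2 * a) \<bullet> b) + (norm (u * b))\<^sup>2"
  unfolding power2_norm_eq_inner inner_vec_def
  by (simp add: power2_eq_square algebra_simps sum.distrib sum_distrib_left)

lemma scaleR_le_inner_hadamard:
  fixes u a :: "real ^ 'd"
  assumes "vec c \<le> u"
  shows "c * (norm a)\<^sup>2 \<le> (u * a) \<bullet> a"
proof -
  have "c * (norm a)\<^sup>2 = (\<Sum>i\<in>UNIV. c * (a $ i)\<^sup>2)"
    unfolding power2_norm_eq_inner inner_vec_def by (simp add: power2_eq_square sum_distrib_left)
  also have "\<dots> \<le> (\<Sum>i\<in>UNIV. u $ i * (a $ i)\<^sup>2)"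
    using assms by (intro sum_mono mult_right_mono) (auto simp: less_eq_vec_def)
  also have "\<dots> = (u * a) \<bullet> a"
    unfolding inner_vec_def by (simp add: power2_eq_square algebra_simps)
  finally show ?thesis .
qed

section \<open>A pathwise energy inequality\<close>

text \<open>Convexity of the squared norm at \<open>(1 - t) a + t (- b / t)\<close>; the gap is
  \<open>(1 - t) t (norm (a + b / t))\<^sup>2\<close>.\<close>
lemma norm_sq_convex_comb:
  fixes a b :: "'b::real_inner"
  assumes "0 < t" "t \<le> 1"
  shows "(norm ((1 - t) *\<^sub>R a - b))\<^sup>2 \<le> (1 - t) * (norm a)\<^sup>2 + (norm b)\<^sup>2 / t"
proof -
  have "0 \<le> (1 - t) * t * (norm (a + (1 / t) *\<^sub>R b))\<^sup>2" using assms by simp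
  also have "\<dots> = (1 - t) * (norm a)\<^sup>2 + (norm b)\<^sup>2 / t - (norm ((1 - t) *\<^sub>R a - b))\<^sup>2"
    unfolding power2_norm_eq_inner using assms
    by (simp add: inner_simps inner_commute field_simps power2_eq_square)
  finally show ?thesis by simp
qed

text \<open>By convexity, one step contracts \<open>(norm (D n))\<^sup>2\<close> by \<open>1 - \<mu> n\<close> up to an error
  \<open>(norm (b n))\<^sup>2 / \<mu> n\<close>; dividing by \<open>\<Gamma> n\<close> makes these estimates telescope.
  Since \<open>\<mu> 1 = 1\<close>, the first step erases the arbitrary initial value \<open>D 1\<close>.\<close>
lemma velocity_bound:
  fixes D :: "nat \<Rightarrow> 'b::real_inner"
  assumes rec: "\<And>n. n \<ge> 1 \<Longrightarrow> D (Suc n) = (1 - \<mu> n) *\<^sub>R D n - b n"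
    and \<mu>1: "\<mu> 1 = 1" and \<mu>: "\<And>n. n \<ge> 1 \<Longrightarrow> 0 < \<mu> n \<and> \<mu> n \<le> 1"
    and \<Gamma>pos: "\<And>n. n \<ge> 1 \<Longrightarrow> 0 < \<Gamma> n" and \<Gamma>1: "\<Gamma> 1 = 1"
    and \<Gamma>rec: "\<And>n. n \<ge> 1 \<Longrightarrow> \<Gamma> (Suc n) = (1 - \<mu> (Suc n)) * \<Gamma> n"
    and "n \<ge> 1"
  shows "(norm (D (Suc n)))\<^sup>2 \<le> \<Gamma> n * (\<Sum>k=1..n. (norm (b k))\<^sup>2 / (\<mu> k * \<Gamma> k))"
  using \<open>n \<ge> 1\<close>
proof (induction n rule: nat_induct_at_least)
  case base
  show ?case using rec[of 1] \<mu>1 \<Gamma>1 by simp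
next
  case (Suc n)
  let ?e = "\<lambda>k. (norm (b k))\<^sup>2 / (\<mu> k * \<Gamma> k)"
  have *: "0 < \<mu> (Suc n)" "\<mu> (Suc n) \<le> 1" "\<Gamma> (Suc n) > 0" using \<mu>[of "Suc n"] \<Gamma>pos[of "Suc n"] by auto
  have "(norm (D (Suc (Suc n))))\<^sup>2
      \<le> (1 - \<mu> (Suc n)) * (norm (D (Suc n)))\<^sup>2 + (norm (b (Suc n)))\<^sup>2 / \<mu> (Suc n)"
    using rec[of "Suc n"] norm_sq_convex_comb[OF *(1,2)] by simp
  also have "\<dots> \<le> (1 - \<mu> (Suc n)) * (\<Gamma> n * (\<Sum>k=1..n. ?e k)) + (norm (b (Suc n)))\<^sup>2 / \<mu> (Suc n)"
    using Suc.IH * by (intro add_mono mult_left_mono) auto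
  also have "\<dots> = \<Gamma> (Suc n) * (\<Sum>k=1..n. ?e k) + \<Gamma> (Suc n) * ?e (Suc n)"
  proof -
    have "\<Gamma> (Suc n) * ?e (Suc n) = (norm (b (Suc n)))\<^sup>2 / \<mu> (Suc n)" using * by simp
    then show ?thesis using \<Gamma>rec[OF Suc.hyps] by (simp add: mult.assoc)
  qed
  also have "\<dots> = \<Gamma> (Suc n) * (\<Sum>k=1..Suc n. ?e k)"
    by (simp add: distrib_left)
  finally show ?case .
qed

text \<open>With \<open>a = \<Gamma>\<close>, the inner sums on the right are the constants \<open>C k N\<close> of the theorem.\<close>
lemma sum_swap_tail:
  fixes a e :: "nat \<Rightarrow> real"
  shows "(\<Sum>n=1..N. a n * (\<Sum>k=1..n. e k)) = (\<Sum>k=1..N. (\<Sum>j=k..N. a j) * e k)"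
proof (induction N)
  case (Suc N)
  have "(\<Sum>k=1..Suc N. (\<Sum>j=k..Suc N. a j) * e k)
      = (\<Sum>k=1..N. ((\<Sum>j=k..N. a j) + a (Suc N)) * e k) + a (Suc N) * e (Suc N)"
    by (auto intro!: sum.cong)
  then show ?case using Suc by (simp add: algebra_simps sum.distrib sum_distrib_left)
qed simp

text \<open>The descent lemma is applied at \<open>w\<close>, while the step uses the gradient at \<open>z\<close>; Young's inequality
  bounds the price of this mismatch by \<open>(norm (w - z))\<^sup>2\<close> and the squared length of the step.
  The noise \<open>\<delta>\<close> enters either quadratically or paired with a vector that does not depend on it.\<close>
lemma noisy_descent_step:
  fixes F :: "real ^ 'd \<Rightarrow> real"
  assumes grad: "\<And>x. GDERIV F x :> gradF x"
    and Lip: "\<And>x y. norm (gradF x - gradF y) \<le> L * norm (x - y)" and "L \<ge> 0"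
  shows "F (w - u * (gradF z + \<delta>)) \<le> F w - (u * gradF z) \<bullet> gradF z + L * (norm (u * gradF z))\<^sup>2
    + L / 2 * (norm (w - z))\<^sup>2 + L / 2 * (norm (u * \<delta>))\<^sup>2
    + (L *\<^sub>R (u\<^sup>2 * gradF z) - u * gradF w) \<bullet> \<delta>"
proof -
  define G where "G = gradF z"
  have 1: "F (w - u * (G + \<delta>)) \<le> F w - gradF w \<bullet> (u * (G + \<delta>)) + L / 2 * (norm (u * (G + \<delta>)))\<^sup>2"
    using Lipschitz_gradient_descent[OF grad Lip, of w "- (u * (G + \<delta>))"] by simp
  have 2: "gradF w \<bullet> (u * (G + \<delta>))
      = (u * G) \<bullet> G + (gradF w - G) \<bullet> (u * G) + (u * gradF w) \<bullet> \<delta>"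
    unfolding inner_hadamard by (simp add: distrib_left inner_simps)
  have "- ((gradF w - G) \<bullet> (u * G)) \<le> norm (gradF w - G) * norm (u * G)"
    using norm_cauchy_schwarz[of "- (gradF w - G)" "u * G"] by (simp only: inner_minus_left norm_minus_cancel)
  also have "\<dots> \<le> (L * norm (w - z)) * norm (u * G)"
    using Lip unfolding G_def by (intro mult_right_mono) auto
  also have "\<dots> \<le> L / 2 * (norm (w - z))\<^sup>2 + L / 2 * (norm (u * G))\<^sup>2"
    using mult_left_mono[OF sum_squares_bound[of "norm (w - z)" "norm (u * G)"], of "L / 2"] \<open>L \<ge> 0\<close>
    by (simp add: algebra_simps)
  finally have 3: "- ((gradF w - G) \<bullet> (u * G)) \<le> L / 2 * (norm (w - z))\<^sup>2 + L / 2 * (norm (u * G))\<^sup>2" .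
  have 4: "(L *\<^sub>R (u\<^sup>2 * G) - u * gradF w) \<bullet> \<delta> = L * ((u\<^sup>2 * G) \<bullet> \<delta>) - (u * gradF w) \<bullet> \<delta>"
    by (simp add: inner_diff_left)
  show ?thesis
    using 1 2 3 4 unfolding hadamard_norm_add G_def by (simp add: algebra_simps)
qed

text \<open>The lag \<open>w n - z n\<close> is \<open>1 - \<gamma> n\<close> times the velocity \<open>w n - \<theta> n\<close>, and the bound \<open>B\<close> brings
  in exactly the factor \<open>1 - \<mu> n\<close> that carries \<open>\<Gamma> (n - 1)\<close> to \<open>\<Gamma> n\<close>. Summed over \<open>n\<close>,
  the lags therefore cost each step \<open>k\<close> the amount \<open>B * c k\<close> times the squared norm of
  \<open>(lam k - \<alpha> k) * g k\<close>. Of this, the part quadratic in the gradient \<open>G k\<close> is covered by the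
  lower bound \<open>m k\<close>, the part quadratic in the noise \<open>\<delta> k\<close> by the upper bound \<open>R k\<close>,
  and the rest is linear in \<open>\<delta> k\<close>.\<close>
lemma energy_inequality:
  fixes F :: "real ^ 'd \<Rightarrow> real" and gradF :: "real ^ 'd \<Rightarrow> real ^ 'd" and \<theta> w z g \<gamma> lam \<alpha> :: "nat \<Rightarrow> real ^ 'd"
    and \<mu> \<Gamma> :: "nat \<Rightarrow> real" and N :: nat
  defines "G \<equiv> \<lambda>n. gradF (z n)"
    and "\<delta> \<equiv> \<lambda>n. g n - gradF (z n)"
    and "c \<equiv> \<lambda>n. (\<Sum>j=n..N. \<Gamma> j) / (\<mu> n * \<Gamma> n)"
  assumes grad: "\<And>x. GDERIV F x :> gradF x"
    and Lip: "\<And>x y. norm (gradF x - gradF y) \<le> L * norm (x - y)" and "L \<ge> 0"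
    and z_eq: "\<And>n. n \<ge> 1 \<Longrightarrow> z n = (1 - \<gamma> n) * \<theta> n + \<gamma> n * w n"
    and w_eq: "\<And>n. n \<ge> 1 \<Longrightarrow> w (Suc n) = w n - lam n * g n"
    and \<theta>_eq: "\<And>n. n \<ge> 1 \<Longrightarrow> \<theta> (Suc n) = (1 - \<mu> n) *\<^sub>R \<theta> n + \<mu> n *\<^sub>R w n - \<alpha> n * g n"
    and \<mu>1: "\<mu> 1 = 1" and \<mu>: "\<And>n. n \<ge> 1 \<Longrightarrow> 0 < \<mu> n \<and> \<mu> n \<le> 1"
    and \<Gamma>pos: "\<And>n. n \<ge> 1 \<Longrightarrow> 0 < \<Gamma> n" and \<Gamma>1: "\<Gamma> 1 = 1"
    and \<Gamma>rec: "\<And>n. n \<ge> 1 \<Longrightarrow> \<Gamma> (Suc n) = (1 - \<mu> (Suc n)) * \<Gamma> n"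
    and \<gamma>1: "\<gamma> 1 = 1" and B: "\<And>n. n \<ge> 2 \<Longrightarrow> (norm (1 - \<gamma> n))\<^sup>2 \<le> B * (1 - \<mu> n)" and "B \<ge> 0"
    and lower: "\<And>n. n \<in> {1..N} \<Longrightarrow>
      vec (m n) \<le> lam n - L *\<^sub>R (lam n)\<^sup>2 - (L * B / 2 * c n) *\<^sub>R (lam n - \<alpha> n)\<^sup>2"
    and upper: "\<And>n. n \<in> {1..N} \<Longrightarrow>
      (norm (lam n))\<^sup>2 + B * c n * (norm (lam n - \<alpha> n))\<^sup>2 \<le> R n"
  shows "F (w (Suc N)) + (\<Sum>n=1..N. m n * (norm (G n))\<^sup>2)
    \<le> F (w 1) + (\<Sum>n=1..N. L / 2 * R n * (norm (\<delta> n))\<^sup>2)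
      + (\<Sum>n=1..N. (L *\<^sub>R ((lam n)\<^sup>2 * G n) - lam n * gradF (w n)
          + (L * B * c n) *\<^sub>R ((lam n - \<alpha> n)\<^sup>2 * G n)) \<bullet> \<delta> n)"
proof -
  define b where "b n = (lam n - \<alpha> n) * g n" for n
  define S where "S n = (\<Sum>k=1..n. (norm (b k))\<^sup>2 / (\<mu> k * \<Gamma> k))" for n
  have S_mono: "S n \<le> S (Suc n)" for n
    using \<mu>[of "Suc n"] \<Gamma>pos[of "Suc n"] by (simp add: S_def)
  have vel: "(norm (w (Suc n) - \<theta> (Suc n)))\<^sup>2 \<le> \<Gamma> n * S n" if "n \<ge> 1" for n
    unfolding S_def
    by (rule velocity_bound[of "\<lambda>n. w n - \<theta> n" \<mu> b \<Gamma>, OF _ \<mu>1 \<mu> \<Gamma>pos \<Gamma>1 \<Gamma>rec that])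
       (auto simp: w_eq \<theta>_eq b_def algebra_simps)
  have lag: "(norm (w n - z n))\<^sup>2 \<le> B * (\<Gamma> n * S n)" if n: "n \<ge> 1" for n
  proof (cases "n = 1")
    case True
    then show ?thesis using z_eq[of 1] \<gamma>1 \<open>B \<ge> 0\<close> \<mu>1 \<Gamma>1 by (simp add: S_def)
  next
    case False
    with n obtain k where k: "n = Suc k" "k \<ge> 1" by (cases n) auto
    have "w n - z n = (1 - \<gamma> n) * (w n - \<theta> n)"
      using z_eq[OF n] by (simp add: vec_eq_iff algebra_simps)
    then have "(norm (w n - z n))\<^sup>2 \<le> (norm (1 - \<gamma> n))\<^sup>2 * (norm (w n - \<theta> n))\<^sup>2"
      using norm_hadamard_le[of "1 - \<gamma> n" "w n - \<theta> n"] by (simp flip: power_mult_distrib)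
    also have "\<dots> \<le> (B * (1 - \<mu> n)) * (\<Gamma> k * S k)"
      using B[of n] vel[OF k(2)] k by (intro mult_mono) (auto intro: order_trans[OF zero_le_power2])
    also have "\<dots> = B * (\<Gamma> n * S k)" using \<Gamma>rec[OF k(2)] k by simp
    also have "\<dots> \<le> B * (\<Gamma> n * S n)"
      using S_mono[of k] \<open>B \<ge> 0\<close> \<Gamma>pos[OF n] k by (intro mult_left_mono) auto
    finally show ?thesis .
  qed
  have "(\<Sum>n=1..N. (norm (w n - z n))\<^sup>2) \<le> B * (\<Sum>n=1..N. \<Gamma> n * S n)"
    unfolding sum_distrib_left using lag by (intro sum_mono) auto
  also have "(\<Sum>n=1..N. \<Gamma> n * S n) = (\<Sum>n=1..N. c n * (norm (b n))\<^sup>2)"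
    unfolding S_def sum_swap_tail c_def by (intro sum.cong) auto
  finally have lags: "(\<Sum>n=1..N. (norm (w n - z n))\<^sup>2) \<le> (\<Sum>n=1..N. B * c n * (norm (b n))\<^sup>2)"
    by (simp add: sum_distrib_left mult.assoc)

  \<comment> \<open>\<open>P n\<close> collects what one step contributes apart from the lag.\<close>
  define V where "V n = L *\<^sub>R ((lam n)\<^sup>2 * G n) - lam n * gradF (w n)" for n
  define P where "P n = - ((lam n * G n) \<bullet> G n) + L * (norm (lam n * G n))\<^sup>2
     + L / 2 * (norm (lam n * \<delta> n))\<^sup>2 + V n \<bullet> \<delta> n" for n
  have "F (w (Suc n)) \<le> F (w n) + L / 2 * (norm (w n - z n))\<^sup>2 + P n" if "n \<ge> 1" for n
    using noisy_descent_step[OF grad Lip \<open>L \<ge> 0\<close>, of "w n" "lam n" "z n" "\<delta> n"] w_eq[OF that]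
    unfolding P_def V_def G_def \<delta>_def by simp
  then have "F (w (Suc k)) \<le> F (w 1) + (\<Sum>n=1..k. L / 2 * (norm (w n - z n))\<^sup>2 + P n)" for k
  proof (induction k)
    case (Suc k)
    from Suc.prems[of "Suc k"] Suc.IH[OF Suc.prems] show ?case by simp
  qed simp
  then have "F (w (Suc N)) \<le> F (w 1) + (\<Sum>n=1..N. L / 2 * (norm (w n - z n))\<^sup>2 + P n)" .
  also have "\<dots> \<le> F (w 1) + (\<Sum>n=1..N. L / 2 * (B * c n * (norm (b n))\<^sup>2) + P n)"
    using mult_left_mono[OF lags, of "L / 2"] \<open>L \<ge> 0\<close>
    by (simp add: sum.distrib sum_distrib_left)
  also have "\<dots> \<le> F (w 1) + (\<Sum>n=1..N. - m n * (norm (G n))\<^sup>2 + L / 2 * R n * (norm (\<delta> n))\<^sup>2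
      + (V n + (L * B * c n) *\<^sub>R ((lam n - \<alpha> n)\<^sup>2 * G n)) \<bullet> \<delta> n)"
  proof (intro add_left_mono sum_mono)
    fix n assume n: "n \<in> {1..N}"
    have "c n \<ge> 0"
      unfolding c_def using n \<mu>[of n] \<Gamma>pos[of n] by (auto intro!: divide_nonneg_nonneg sum_nonneg \<Gamma>pos[THEN less_imp_le])
    have b_sq: "(norm (b n))\<^sup>2 = (norm ((lam n - \<alpha> n) * G n))\<^sup>2
        + 2 * (((lam n - \<alpha> n)\<^sup>2 * G n) \<bullet> \<delta> n) + (norm ((lam n - \<alpha> n) * \<delta> n))\<^sup>2"
      unfolding b_def hadamard_norm_add[symmetric] by (simp add: G_def \<delta>_def)
    have sq: "(u\<^sup>2 * a) \<bullet> a = (norm (u * a))\<^sup>2" for u a :: "real ^ 'd"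
      unfolding power2_norm_eq_inner inner_vec_def by (simp add: power2_eq_square algebra_simps)
    have "m n * (norm (G n))\<^sup>2
        \<le> ((lam n - L *\<^sub>R (lam n)\<^sup>2 - (L * B / 2 * c n) *\<^sub>R (lam n - \<alpha> n)\<^sup>2) * G n) \<bullet> G n"
      by (rule scaleR_le_inner_hadamard[OF lower[OF n]])
    also have "\<dots> = (lam n * G n) \<bullet> G n - L * (norm (lam n * G n))\<^sup>2
        - L * B / 2 * c n * (norm ((lam n - \<alpha> n) * G n))\<^sup>2"
      by (simp add: left_diff_distrib inner_diff_left scaleR_hadamard sq)
    finally have drift: "m n * (norm (G n))\<^sup>2 \<le> \<dots>" .
    have had_sq: "(norm (u * v))\<^sup>2 \<le> (norm u)\<^sup>2 * (norm v)\<^sup>2" for u v :: "real ^ 'd"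
      using norm_hadamard_le[of u v] by (simp flip: power_mult_distrib)
    have "(norm (lam n * \<delta> n))\<^sup>2 + B * c n * (norm ((lam n - \<alpha> n) * \<delta> n))\<^sup>2
        \<le> (norm (lam n))\<^sup>2 * (norm (\<delta> n))\<^sup>2 + B * c n * ((norm (lam n - \<alpha> n))\<^sup>2 * (norm (\<delta> n))\<^sup>2)"
      using had_sq \<open>B \<ge> 0\<close> \<open>c n \<ge> 0\<close> by (intro add_mono mult_left_mono) auto
    also have "\<dots> = ((norm (lam n))\<^sup>2 + B * c n * (norm (lam n - \<alpha> n))\<^sup>2) * (norm (\<delta> n))\<^sup>2"
      by (simp add: algebra_simps)
    also have "\<dots> \<le> R n * (norm (\<delta> n))\<^sup>2"
      using upper[OF n] by (intro mult_right_mono) auto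
    finally have "L / 2 * ((norm (lam n * \<delta> n))\<^sup>2 + B * c n * (norm ((lam n - \<alpha> n) * \<delta> n))\<^sup>2)
        \<le> L / 2 * (R n * (norm (\<delta> n))\<^sup>2)"
      using \<open>L \<ge> 0\<close> by (intro mult_left_mono) auto
    then show "L / 2 * (B * c n * (norm (b n))\<^sup>2) + P n \<le> - m n * (norm (G n))\<^sup>2
        + L / 2 * R n * (norm (\<delta> n))\<^sup>2
        + (V n + (L * B * c n) *\<^sub>R ((lam n - \<alpha> n)\<^sup>2 * G n)) \<bullet> \<delta> n"
      using drift unfolding b_sq P_def inner_add_left by (simp add: algebra_simps)
  qed
  finally show ?thesis
    unfolding V_def sum.distrib by (simp add: sum_negf)
qed

section \<open>Square-integrable random vectors\<close>

lemma borel_measurable_hadamard [measurable (raw)]: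
  fixes U V :: "'a \<Rightarrow> real ^ 'd"
  assumes "U \<in> borel_measurable M" "V \<in> borel_measurable M"
  shows "(\<lambda>\<omega>. U \<omega> * V \<omega>) \<in> borel_measurable M"
  by (rule borel_measurable_continuous_Pair[OF assms])
     (auto simp: times_vec_def intro!: continuous_intros)

lemma borel_measurable_vec_component [measurable (raw)]:
  fixes U :: "'a \<Rightarrow> real ^ 'd"
  assumes "U \<in> borel_measurable M"
  shows "(\<lambda>\<omega>. U \<omega> $ i) \<in> borel_measurable M"
  using assms by (intro borel_measurable_continuous_on[OF _ assms]) (auto intro!: continuous_intros)

definition sq_integrable :: "'a measure \<Rightarrow> ('a \<Rightarrow> 'b::euclidean_space) \<Rightarrow> bool" where
  "sq_integrable M X \<longleftrightarrow> X \<in> borel_measurable M \<and> integrable M (\<lambda>\<omega>. (norm (X \<omega>))\<^sup>2)"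

lemma sq_integrable_measurable: "sq_integrable M X \<Longrightarrow> X \<in> borel_measurable M"
  and sq_integrable_integrable: "sq_integrable M X \<Longrightarrow> integrable M (\<lambda>\<omega>. (norm (X \<omega>))\<^sup>2)"
  by (auto simp: sq_integrable_def)

lemma sq_integrable_bound:
  assumes "X \<in> borel_measurable M" "integrable M f" "AE \<omega> in M. (norm (X \<omega>))\<^sup>2 \<le> f \<omega>"
  shows "sq_integrable M X"
proof -
  have "integrable M (\<lambda>\<omega>. (norm (X \<omega>))\<^sup>2)"
    by (rule Bochner_Integration.integrable_bound[OF assms(2)])
       (use assms in \<open>auto elim!: eventually_mono\<close>)
  with assms show ?thesis by (simp add: sq_integrable_def)
qed

lemma sq_integrable_dominated:
  assumes "X \<in> borel_measurable M" "sq_integrable M Y" "AE \<omega> in M. norm (X \<omega>) \<le> K * norm (Y \<omega>)"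
  shows "sq_integrable M X"
proof (rule sq_integrable_bound[OF assms(1)])
  show "integrable M (\<lambda>\<omega>. K\<^sup>2 * (norm (Y \<omega>))\<^sup>2)"
    using assms by (auto simp: sq_integrable_def)
  show "AE \<omega> in M. (norm (X \<omega>))\<^sup>2 \<le> K\<^sup>2 * (norm (Y \<omega>))\<^sup>2"
    using assms(3) by eventually_elim (metis norm_ge_zero power_mono power_mult_distrib)
qed

lemma sq_integrable_add:
  assumes "sq_integrable M X" "sq_integrable M Y"
  shows "sq_integrable M (\<lambda>\<omega>. X \<omega> + Y \<omega>)"
proof (rule sq_integrable_bound)
  show "(\<lambda>\<omega>. X \<omega> + Y \<omega>) \<in> borel_measurable M"
    using assms by (auto simp: sq_integrable_def)
  show "integrable M (\<lambda>\<omega>. 2 * (norm (X \<omega>))\<^sup>2 + 2 * (norm (Y \<omega>))\<^sup>2)"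
    using assms by (auto simp: sq_integrable_def)
  have "(norm (x + y))\<^sup>2 \<le> 2 * (norm x)\<^sup>2 + 2 * (norm y)\<^sup>2" for x y :: 'b
    using zero_le_power2[of "norm (x - y)"]
    by (simp only: power2_norm_eq_inner) (simp add: inner_simps inner_commute)
  then show "AE \<omega> in M. (norm (X \<omega> + Y \<omega>))\<^sup>2 \<le> 2 * (norm (X \<omega>))\<^sup>2 + 2 * (norm (Y \<omega>))\<^sup>2" by simp
qed

lemma sq_integrable_scaleR:
  "sq_integrable M X \<Longrightarrow> sq_integrable M (\<lambda>\<omega>. c *\<^sub>R X \<omega>)"
  by (rule sq_integrable_dominated[of _ M X "\<bar>c\<bar>"]) (auto simp: sq_integrable_def)

lemma sq_integrable_diff:
  "sq_integrable M X \<Longrightarrow> sq_integrable M Y \<Longrightarrow> sq_integrable M (\<lambda>\<omega>. X \<omega> - Y \<omega>)"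
  using sq_integrable_add[of M X "\<lambda>\<omega>. (- 1) *\<^sub>R Y \<omega>"] sq_integrable_scaleR[of M Y "- 1"] by simp

lemma sq_integrable_hadamard:
  fixes U X :: "'a \<Rightarrow> real ^ 'd"
  assumes "U \<in> borel_measurable M" "AE \<omega> in M. norm (U \<omega>) \<le> K" "sq_integrable M X"
  shows "sq_integrable M (\<lambda>\<omega>. U \<omega> * X \<omega>)"
proof (rule sq_integrable_dominated)
  show "(\<lambda>\<omega>. U \<omega> * X \<omega>) \<in> borel_measurable M"
    using assms by (auto simp: sq_integrable_def intro: borel_measurable_hadamard)
  show "AE \<omega> in M. norm (U \<omega> * X \<omega>) \<le> K * norm (X \<omega>)"
    using assms(2) by eventually_elim
      (meson norm_hadamard_le mult_right_mono norm_ge_zero order_trans)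
qed fact

lemma integrable_inner_sq_integrable:
  assumes "sq_integrable M X" "sq_integrable M Y"
  shows "integrable M (\<lambda>\<omega>. X \<omega> \<bullet> Y \<omega>)"
proof (rule Bochner_Integration.integrable_bound)
  show "integrable M (\<lambda>\<omega>. (norm (X \<omega>))\<^sup>2 + (norm (Y \<omega>))\<^sup>2)"
    using assms by (auto simp: sq_integrable_def)
  have "\<bar>x \<bullet> y\<bar> \<le> (norm x)\<^sup>2 + (norm y)\<^sup>2" for x y :: 'b
  proof -
    have "2 * (norm x * norm y) \<le> (norm x)\<^sup>2 + (norm y)\<^sup>2"
      using sum_squares_bound[of "norm x" "norm y"] by simp
    moreover have "0 \<le> norm x * norm y" by simp
    ultimately show ?thesis using Cauchy_Schwarz_ineq2[of x y] by linarith
  qed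
  then show "AE \<omega> in M. norm (X \<omega> \<bullet> Y \<omega>) \<le> norm ((norm (X \<omega>))\<^sup>2 + (norm (Y \<omega>))\<^sup>2)" by simp
qed (use assms in \<open>auto simp: sq_integrable_def\<close>)

lemma sq_integrable_component:
  fixes X :: "'a \<Rightarrow> real ^ 'd"
  assumes "sq_integrable M X"
  shows "sq_integrable M (\<lambda>\<omega>. X \<omega> $ i)"
  by (rule sq_integrable_dominated[of _ M X 1])
     (use assms in \<open>auto simp: sq_integrable_def component_le_norm_cart intro: borel_measurable_vec_component\<close>)

section \<open>Unbiased noise of bounded variance\<close>

text \<open>The hypothesis uses the conditional expectation of nonnegative functions, which exists without
  integrability; square integrability is a conclusion.\<close>
lemma (in sigma_finite_subalgebra) second_moment_le_of_nn_cond_exp_le: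
  fixes X :: "'a \<Rightarrow> 'b::euclidean_space"
  assumes "prob_space M" and X: "X \<in> borel_measurable M"
    and var: "AE \<omega> in M. nn_cond_exp M F (\<lambda>\<omega>'. ennreal ((norm (X \<omega>'))\<^sup>2)) \<omega> \<le> ennreal (s\<^sup>2)"
  shows "sq_integrable M X" "(\<integral>\<omega>. (norm (X \<omega>))\<^sup>2 \<partial>M) \<le> s\<^sup>2"
proof -
  interpret prob_space M by fact
  have "(\<integral>\<^sup>+ \<omega>. ennreal ((norm (X \<omega>))\<^sup>2) \<partial>M)
      = (\<integral>\<^sup>+ \<omega>. nn_cond_exp M F (\<lambda>\<omega>'. ennreal ((norm (X \<omega>'))\<^sup>2)) \<omega> \<partial>M)"
    using nn_cond_exp_intg[of "\<lambda>_. 1" "\<lambda>\<omega>'. ennreal ((norm (X \<omega>'))\<^sup>2)"] X by simp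
  also have "\<dots> \<le> (\<integral>\<^sup>+ \<omega>. ennreal (s\<^sup>2) \<partial>M)"
    by (rule nn_integral_mono_AE[OF var])
  also have "\<dots> = ennreal (s\<^sup>2)" by (simp add: emeasure_space_1)
  finally have *: "(\<integral>\<^sup>+ \<omega>. ennreal ((norm (X \<omega>))\<^sup>2) \<partial>M) \<le> ennreal (s\<^sup>2)" .
  then have int: "integrable M (\<lambda>\<omega>. (norm (X \<omega>))\<^sup>2)"
    using X by (intro integrableI_bounded) (auto intro: le_less_trans)
  with X show "sq_integrable M X" by (simp add: sq_integrable_def)
  show "(\<integral>\<omega>. (norm (X \<omega>))\<^sup>2 \<partial>M) \<le> s\<^sup>2"
    using * nn_integral_eq_integral[OF int] by simp
qed

text \<open>Square integrability makes each product \<open>V \<omega> $ i * X \<omega> $ i\<close> integrable, so the known factor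
  can be taken out of the conditional expectation componentwise.\<close>
lemma (in finite_measure_subalgebra) expectation_inner_unbiased_noise:
  fixes V X Y :: "'a \<Rightarrow> real ^ 'd"
  assumes V: "V \<in> borel_measurable F" "sq_integrable M V"
    and Y: "Y \<in> borel_measurable F" "sq_integrable M Y"
    and X: "sq_integrable M X"
    and cond: "AE \<omega> in M. vec_cond_exp M F X \<omega> = Y \<omega>"
  shows "(\<integral>\<omega>. V \<omega> \<bullet> (X \<omega> - Y \<omega>) \<partial>M) = 0"
proof -
  have "(\<integral>\<omega>. V \<omega> $ i * X \<omega> $ i \<partial>M) = (\<integral>\<omega>. V \<omega> $ i * Y \<omega> $ i \<partial>M)" for i
  proof -
    have "(\<integral>\<omega>. V \<omega> $ i * X \<omega> $ i \<partial>M)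
        = (\<integral>\<omega>. V \<omega> $ i * real_cond_exp M F (\<lambda>\<omega>. X \<omega> $ i) \<omega> \<partial>M)"
      using integrable_inner_sq_integrable[OF V(2)[THEN sq_integrable_component] X[THEN sq_integrable_component], of i i]
      by (intro real_cond_exp_intg(2)[symmetric])
         (auto intro!: borel_measurable_vec_component V X[THEN sq_integrable_measurable])
    also have "\<dots> = (\<integral>\<omega>. V \<omega> $ i * Y \<omega> $ i \<partial>M)"
    proof (rule integral_cong_AE)
      show "(\<lambda>\<omega>. V \<omega> $ i * real_cond_exp M F (\<lambda>\<omega>. X \<omega> $ i) \<omega>) \<in> borel_measurable M"
        "(\<lambda>\<omega>. V \<omega> $ i * Y \<omega> $ i) \<in> borel_measurable M"
        using V(2) Y(2) by (auto intro!: borel_measurable_times borel_measurable_vec_component dest: sq_integrable_measurable)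
      show "AE \<omega> in M. V \<omega> $ i * real_cond_exp M F (\<lambda>\<omega>. X \<omega> $ i) \<omega> = V \<omega> $ i * Y \<omega> $ i"
        using cond by eventually_elim (simp add: vec_cond_exp_def vec_eq_iff)
    qed
    finally show ?thesis .
  qed
  moreover have "integrable M (\<lambda>\<omega>. V \<omega> $ i * X \<omega> $ i)" "integrable M (\<lambda>\<omega>. V \<omega> $ i * Y \<omega> $ i)" for i
    using integrable_inner_sq_integrable[OF V(2)[THEN sq_integrable_component] X[THEN sq_integrable_component], of i i]
      integrable_inner_sq_integrable[OF V(2)[THEN sq_integrable_component] Y(2)[THEN sq_integrable_component], of i i]
    by auto
  ultimately show ?thesis
    unfolding inner_vec_def by (simp add: right_diff_distrib)
qed

section \<open>From weighted sums to the lower limit\<close>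

lemma AE_bounded_partial_sums:
  fixes h :: "nat \<Rightarrow> 'a \<Rightarrow> real"
  assumes int: "\<And>n. n \<ge> 1 \<Longrightarrow> integrable M (h n)" and nn: "\<And>n \<omega>. n \<ge> 1 \<Longrightarrow> 0 \<le> h n \<omega>"
    and bd: "\<And>N. (\<Sum>n=1..N. \<integral>\<omega>. h n \<omega> \<partial>M) \<le> K"
  shows "AE \<omega> in M. \<exists>K'. \<forall>N. (\<Sum>n=1..N. h n \<omega>) \<le> K'"
proof -
  have meas: "(\<lambda>\<omega>. ennreal (h (Suc n) \<omega>)) \<in> borel_measurable M" for n
    using int[of "Suc n"] by auto
  have "(\<integral>\<^sup>+ \<omega>. (\<Sum>n. ennreal (h (Suc n) \<omega>)) \<partial>M) = (\<Sum>n. \<integral>\<^sup>+ \<omega>. ennreal (h (Suc n) \<omega>) \<partial>M)"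
    by (rule nn_integral_suminf[OF meas])
  also have "\<dots> \<le> ennreal K"
  proof (rule suminf_le_const[OF summableI])
    fix N
    have "(\<Sum>n<N. \<integral>\<^sup>+ \<omega>. ennreal (h (Suc n) \<omega>) \<partial>M) = (\<Sum>n<N. ennreal (\<integral>\<omega>. h (Suc n) \<omega> \<partial>M))"
      using int nn by (intro sum.cong nn_integral_eq_integral) auto
    also have "\<dots> = ennreal (\<Sum>n<N. \<integral>\<omega>. h (Suc n) \<omega> \<partial>M)"
      using nn by (intro sum_ennreal integral_nonneg_AE) auto
    also have "\<dots> \<le> ennreal K"
      using bd[of N] by (simp add: sum.atLeast1_atMost_eq ennreal_leI)
    finally show "(\<Sum>n<N. \<integral>\<^sup>+ \<omega>. ennreal (h (Suc n) \<omega>) \<partial>M) \<le> ennreal K" .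
  qed
  finally have "(\<integral>\<^sup>+ \<omega>. (\<Sum>n. ennreal (h (Suc n) \<omega>)) \<partial>M) \<noteq> \<infinity>"
    by (auto simp: top_unique)
  then have "AE \<omega> in M. (\<Sum>n. ennreal (h (Suc n) \<omega>)) \<noteq> \<infinity>"
    using meas by (intro nn_integral_PInf_AE) auto
  then show ?thesis
  proof eventually_elim
    case (elim \<omega>)
    define K' where "K' = enn2real (\<Sum>n. ennreal (h (Suc n) \<omega>))"
    have "(\<Sum>n=1..N. h n \<omega>) \<le> K'" for N
    proof -
      have "ennreal (\<Sum>n=1..N. h n \<omega>) = (\<Sum>n<N. ennreal (h (Suc n) \<omega>))"
        using nn by (simp add: sum.atLeast1_atMost_eq sum_ennreal)
      also have "\<dots> \<le> (\<Sum>n. ennreal (h (Suc n) \<omega>))" by (intro sum_le_suminf) auto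
      also have "\<dots> = ennreal K'" using elim by (simp add: K'_def less_top)
      finally show ?thesis by (simp add: K'_def)
    qed
    then show ?case by blast
  qed
qed

text \<open>If \<open>x\<close> stayed above some \<open>c > 0\<close> from an index \<open>n0\<close> on, the bounded sums would dominate
  \<open>c\<^sup>2\<close> times the tail of the divergent ones.\<close>
lemma liminf_zero_of_weighted_square_sums:
  fixes x m :: "nat \<Rightarrow> real"
  assumes nn: "\<And>n. 0 \<le> x n" and m: "\<And>n. n \<ge> 1 \<Longrightarrow> 0 < m n"
    and bd: "\<And>N. (\<Sum>n=1..N. m n * (x n)\<^sup>2) \<le> K"
    and div: "filterlim (\<lambda>N. \<Sum>n=1..N. m n) at_top sequentially"
  shows "liminf (\<lambda>n. ereal (x n)) = 0"
proof (rule antisym)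
  show "0 \<le> liminf (\<lambda>n. ereal (x n))" using nn by (intro Liminf_bounded) auto
  show "liminf (\<lambda>n. ereal (x n)) \<le> 0"
  proof (rule ccontr)
    assume "\<not> ?thesis"
    then obtain c where c: "0 < ereal c" "ereal c < liminf (\<lambda>n. ereal (x n))"
      using ereal_dense2[of 0] by (auto simp: not_le)
    then obtain n0 where n0: "\<And>n. n \<ge> n0 \<Longrightarrow> c < x n"
      using less_LiminfD[OF c(2)] by (auto simp: eventually_sequentially)
    have "(\<Sum>n=1..N. m n) \<le> (\<Sum>n=1..n0. m n) + K / c\<^sup>2" for N
    proof -
      have "c\<^sup>2 * (\<Sum>n=1..N. m n) \<le> (\<Sum>n=1..N. (if n \<le> n0 then c\<^sup>2 * m n else 0) + m n * (x n)\<^sup>2)"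
        unfolding sum_distrib_left
      proof (rule sum_mono)
        fix n assume "n \<in> {1..N}"
        then have "0 < m n" using m by simp
        moreover have "c\<^sup>2 \<le> (x n)\<^sup>2" if "\<not> n \<le> n0"
          using n0[of n] that c(1) by (intro power_mono) auto
        ultimately show "c\<^sup>2 * m n \<le> (if n \<le> n0 then c\<^sup>2 * m n else 0) + m n * (x n)\<^sup>2"
          by (auto simp: mult.commute)
      qed
      also have "\<dots> = (\<Sum>n\<in>{1..N} \<inter> {..n0}. c\<^sup>2 * m n) + (\<Sum>n=1..N. m n * (x n)\<^sup>2)"
        by (simp only: sum.distrib sum.inter_restrict[OF finite_atLeastAtMost] atMost_iff)
      also have "\<dots> \<le> (\<Sum>n=1..n0. c\<^sup>2 * m n) + K"
        using m by (intro add_mono bd sum_mono2) (auto simp: less_imp_le)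
      finally show ?thesis using c(1) by (simp add: field_simps sum_distrib_left)
    qed
    moreover obtain N where "(\<Sum>n=1..N. m n) > (\<Sum>n=1..n0. m n) + K / c\<^sup>2"
      using div unfolding filterlim_at_top_dense eventually_sequentially by blast
    ultimately show False by (meson not_le)
  qed
qed

section \<open>Convergence of the gradients\<close>

theorem mainTheorem3:
  fixes M :: "'a measure"
    and Fs :: "nat \<Rightarrow> 'a measure"
    and F :: "real ^ 'd \<Rightarrow> real"
    and gradF :: "real ^ 'd \<Rightarrow> real ^ 'd"
    and \<theta> w z y g \<delta> \<gamma> lam \<alpha> :: "nat \<Rightarrow> 'a \<Rightarrow> real ^ 'd"
    and \<mu> \<Gamma> m :: "nat \<Rightarrow> real"
    and C R :: "nat \<Rightarrow> nat \<Rightarrow> real"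
    and L B \<sigma> :: real
  assumes "prob_space M"
    and F_grad: "\<And>x. GDERIV F x :> gradF x"
    and F_C1: "continuous_on UNIV gradF"
    and F_bdd: "bdd_below (range F)"
    and L_pos: "L > 0"
    and F_Lipschitz: "\<And>x x'. norm (gradF x - gradF x') \<le> L * norm (x - x')"
    and meas: "\<And>n. n \<ge> 1 \<Longrightarrow> \<theta> n \<in> borel_measurable M"
              "\<And>n. n \<ge> 1 \<Longrightarrow> w n \<in> borel_measurable M"
              "\<And>n. n \<ge> 1 \<Longrightarrow> z n \<in> borel_measurable M"
              "\<And>n. n \<ge> 1 \<Longrightarrow> y n \<in> borel_measurable M"
              "\<And>n. n \<ge> 1 \<Longrightarrow> g n \<in> borel_measurable M"
              "\<And>n. n \<ge> 1 \<Longrightarrow> \<gamma> n \<in> borel_measurable M"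
              "\<And>n. n \<ge> 1 \<Longrightarrow> lam n \<in> borel_measurable M"
              "\<And>n. n \<ge> 1 \<Longrightarrow> \<alpha> n \<in> borel_measurable M"
    and init: "integrable M (\<lambda>\<omega>. F (w 1 \<omega>))"
    and z_eq: "\<And>n \<omega>. n \<ge> 1 \<Longrightarrow> \<omega> \<in> space M \<Longrightarrow>
                 z n \<omega> = (1 - \<gamma> n \<omega>) * \<theta> n \<omega> + \<gamma> n \<omega> * w n \<omega>"
    and y_eq: "\<And>n \<omega>. n \<ge> 1 \<Longrightarrow> \<omega> \<in> space M \<Longrightarrow>
                 y n \<omega> = (1 - \<mu> n) *\<^sub>R \<theta> n \<omega> + \<mu> n *\<^sub>R w n \<omega>"
    and w_eq: "\<And>n \<omega>. n \<ge> 1 \<Longrightarrow> \<omega> \<in> space M \<Longrightarrow>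
                 w (Suc n) \<omega> = w n \<omega> - lam n \<omega> * g n \<omega>"
    and \<theta>_eq: "\<And>n \<omega>. n \<ge> 1 \<Longrightarrow> \<omega> \<in> space M \<Longrightarrow>
                 \<theta> (Suc n) \<omega> = y n \<omega> - \<alpha> n \<omega> * g n \<omega>"
    and \<mu>_1: "\<mu> 1 = 1"
    and \<mu>_range: "\<And>n. n \<ge> 2 \<Longrightarrow> 0 < \<mu> n \<and> \<mu> n < 1"
    and \<gamma>_pos: "\<And>n. n \<ge> 1 \<Longrightarrow> AE \<omega> in M. pos_vec (\<gamma> n \<omega>)"
    and \<gamma>_bdd: "AE \<omega> in M. bounded ((\<lambda>n. \<gamma> n \<omega>) ` {1..})"
    and \<gamma>_1: "\<And>\<omega>. \<omega> \<in> space M \<Longrightarrow> \<gamma> 1 \<omega> = 1"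
    and lam_pos: "\<And>n. n \<ge> 1 \<Longrightarrow> AE \<omega> in M. pos_vec (lam n \<omega>)"
    and \<alpha>_pos: "\<And>n. n \<ge> 1 \<Longrightarrow> AE \<omega> in M. pos_vec (\<alpha> n \<omega>)"
    and lam_bdd: "\<exists>K. \<forall>n\<ge>1. AE \<omega> in M. norm (lam n \<omega>) \<le> K"
    and \<alpha>_bdd: "\<exists>K. \<forall>n\<ge>1. AE \<omega> in M. norm (\<alpha> n \<omega>) \<le> K"
    and B: "\<And>n. n \<ge> 2 \<Longrightarrow> AE \<omega> in M. (norm (1 - \<gamma> n \<omega>))\<^sup>2 / (1 - \<mu> n) \<le> B"
    and \<delta>_eq: "\<And>n \<omega>. n \<ge> 1 \<Longrightarrow> \<omega> \<in> space M \<Longrightarrow> \<delta> n \<omega> = g n \<omega> - gradF (z n \<omega>)"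
    and subalg: "\<And>n. n \<ge> 1 \<Longrightarrow> subalgebra M (Fs n)"
    and incr: "\<And>n. n \<ge> 1 \<Longrightarrow> sets (Fs n) \<subseteq> sets (Fs (Suc n))"
    and adapted: "\<And>n. n \<ge> 1 \<Longrightarrow> w n \<in> borel_measurable (Fs n)"
                 "\<And>n. n \<ge> 1 \<Longrightarrow> z n \<in> borel_measurable (Fs n)"
                 "\<And>n. n \<ge> 1 \<Longrightarrow> lam n \<in> borel_measurable (Fs n)"
                 "\<And>n. n \<ge> 1 \<Longrightarrow> \<alpha> n \<in> borel_measurable (Fs n)"
    and unbiased: "\<And>n. n \<ge> 1 \<Longrightarrow> AE \<omega> in M. vec_cond_exp M (Fs n) (g n) \<omega> = gradF (z n \<omega>)"
    and \<sigma>_pos: "\<sigma> > 0"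
    and variance: "\<And>n. n \<ge> 1 \<Longrightarrow>
          AE \<omega> in M. nn_cond_exp M (Fs n) (\<lambda>\<omega>'. ennreal ((norm (\<delta> n \<omega>'))\<^sup>2)) \<omega> \<le> ennreal (\<sigma>\<^sup>2)"
    and \<Gamma>_1: "\<Gamma> 1 = 1"
    and \<Gamma>_rec: "\<And>n. n \<ge> 2 \<Longrightarrow> \<Gamma> n = (1 - \<mu> n) * \<Gamma> (n - 1)"
    and C_eq: "\<And>n N. 1 \<le> n \<Longrightarrow> n \<le> N \<Longrightarrow> C n N = (\<Sum>j=n..N. \<Gamma> j)"
    and \<Gamma>_bdd: "bounded (\<Gamma> ` {1..})"
    and C_bdd: "\<And>N. N \<ge> 1 \<Longrightarrow> \<exists>K>0. \<forall>n\<in>{1..N}. C n N \<le> K"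
    and m_pos: "\<And>n. n \<ge> 1 \<Longrightarrow> m n > 0"
    and R_pos: "\<And>n N. 1 \<le> n \<Longrightarrow> n \<le> N \<Longrightarrow> R n N > 0"
    and step_lower: "\<And>n N. 1 \<le> n \<Longrightarrow> n \<le> N \<Longrightarrow>
          AE \<omega> in M. vec (m n) \<le> lam n \<omega> - L *\<^sub>R (lam n \<omega>)\<^sup>2
            - (L * B / 2 * (C n N / (\<mu> n * \<Gamma> n))) *\<^sub>R (lam n \<omega> - \<alpha> n \<omega>)\<^sup>2"
    and step_upper: "\<And>n N. 1 \<le> n \<Longrightarrow> n \<le> N \<Longrightarrow>
          AE \<omega> in M. (norm (lam n \<omega>))\<^sup>2
            + B * (C n N / (\<mu> n * \<Gamma> n)) * (norm (lam n \<omega> - \<alpha> n \<omega>))\<^sup>2 \<le> R n N"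
    and R_sum: "convergent (\<lambda>N. \<sigma>\<^sup>2 * (\<Sum>n=1..N. R n N))"
    and m_sum: "filterlim (\<lambda>N. \<Sum>n=1..N. m n) at_top sequentially"
  shows "AE \<omega> in M. liminf (\<lambda>n. ereal (norm (gradF (z n \<omega>)))) = 0"
proof -
  interpret prob_space M by fact
  have sub: "finite_measure_subalgebra M (Fs n)" if "n \<ge> 1" for n
    using subalg[OF that] by (simp add: finite_measure_subalgebra_def finite_measure_subalgebra_axioms_def finite_measure_axioms)
  obtain l where l: "\<And>x. l \<le> F x"
    using F_bdd by (auto simp: bdd_below_def)
  obtain Kl where Kl: "\<And>n. n \<ge> 1 \<Longrightarrow> AE \<omega> in M. norm (lam n \<omega>) \<le> Kl" using lam_bdd by blast
  obtain Ka where Ka: "\<And>n. n \<ge> 1 \<Longrightarrow> AE \<omega> in M. norm (\<alpha> n \<omega>) \<le> Ka" using \<alpha>_bdd by blast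
  have Kla: "AE \<omega> in M. norm (lam n \<omega> - \<alpha> n \<omega>) \<le> Kl + Ka" if "n \<ge> 1" for n
    using Kl[OF that] Ka[OF that]
    by eventually_elim (meson add_mono norm_triangle_ineq4 order_trans)

  have \<mu>: "0 < \<mu> n \<and> \<mu> n \<le> 1" if "n \<ge> 1" for n
    using \<mu>_range[of n] \<mu>_1 that by (cases "n = 1") auto
  have \<Gamma>rec: "\<Gamma> (Suc n) = (1 - \<mu> (Suc n)) * \<Gamma> n" if "n \<ge> 1" for n
    using \<Gamma>_rec[of "Suc n"] that by simp
  have \<Gamma>pos: "0 < \<Gamma> n" if "n \<ge> 1" for n
    using that
  proof (induction n rule: nat_induct_at_least)
    case (Suc n)
    then show ?case using \<mu>_range[of "Suc n"] \<Gamma>rec[of n] by simp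
  qed (use \<Gamma>_1 in simp)
  have AE_B: "AE \<omega> in M. (norm (1 - \<gamma> n \<omega>))\<^sup>2 \<le> B * (1 - \<mu> n)" if "n \<ge> 2" for n
    using B[OF that] by eventually_elim (use \<mu>_range[OF that] in \<open>simp add: field_simps\<close>)
  have "AE \<omega> in M. 0 \<le> B"
    using B[OF order_refl]
    by eventually_elim (use \<mu>_range[OF order_refl] in \<open>auto elim: order_trans[rotated]\<close>)
  then have "0 \<le> B" by simp

  have gradF_meas: "gradF \<in> borel_measurable borel"
    by (rule borel_measurable_continuous_onI[OF F_C1])
  have F_meas: "F \<in> borel_measurable borel"
    by (rule borel_measurable_continuous_onI[OF GDERIV_imp_continuous_on[OF F_grad]])

  have \<delta>_meas: "\<delta> n \<in> borel_measurable M" if n: "n \<ge> 1" for n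
    using meas(5)[OF n] measurable_compose[OF meas(3)[OF n] gradF_meas]
    by (subst measurable_cong[OF \<delta>_eq[OF n]]) auto
  have \<delta>_sq: "sq_integrable M (\<delta> n)" and \<delta>_var: "(\<integral>\<omega>. (norm (\<delta> n \<omega>))\<^sup>2 \<partial>M) \<le> \<sigma>\<^sup>2" if n: "n \<ge> 1" for n
  proof -
    interpret fin_sub: finite_measure_subalgebra M "Fs n" by (rule sub[OF n])
    show "sq_integrable M (\<delta> n)" "(\<integral>\<omega>. (norm (\<delta> n \<omega>))\<^sup>2 \<partial>M) \<le> \<sigma>\<^sup>2"
      using fin_sub.second_moment_le_of_nn_cond_exp_le[OF prob_space_axioms \<delta>_meas[OF n] variance[OF n]] by auto
  qed

  \<comment> \<open>The expectations below make sense only once all gradients are known to be square integrable,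
    and this has to be propagated along the iteration. The velocity is recorded with the factor
    \<open>1 - \<mu> n\<close>, which vanishes for \<open>n = 1\<close>: no moment of the initial \<open>\<theta> 1\<close> is assumed.\<close>
  define reg where "reg n \<longleftrightarrow> integrable M (\<lambda>\<omega>. F (w n \<omega>)) \<and> sq_integrable M (\<lambda>\<omega>. w n \<omega> - z n \<omega>)
      \<and> sq_integrable M (\<lambda>\<omega>. (1 - \<mu> n) *\<^sub>R (w n \<omega> - \<theta> n \<omega>))" for n
  have gradw_sq: "sq_integrable M (\<lambda>\<omega>. gradF (w n \<omega>))" if "reg n" "n \<ge> 1" for n
  proof (rule sq_integrable_bound)
    show "integrable M (\<lambda>\<omega>. 2 * L * (F (w n \<omega>) - l))" using that by (auto simp: reg_def)
    show "AE \<omega> in M. (norm (gradF (w n \<omega>)))\<^sup>2 \<le> 2 * L * (F (w n \<omega>) - l)"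
      using Lipschitz_gradient_norm_bound[OF F_grad F_Lipschitz L_pos l] by simp
    show "(\<lambda>\<omega>. gradF (w n \<omega>)) \<in> borel_measurable M"
      using measurable_compose[OF meas(2)[OF that(2)] gradF_meas] .
  qed
  have gradz_sq: "sq_integrable M (\<lambda>\<omega>. gradF (z n \<omega>))" if "reg n" "n \<ge> 1" for n
  proof -
    have "sq_integrable M (\<lambda>\<omega>. gradF (w n \<omega>) - gradF (z n \<omega>))"
    proof (rule sq_integrable_dominated)
      show "(\<lambda>\<omega>. gradF (w n \<omega>) - gradF (z n \<omega>)) \<in> borel_measurable M"
        using measurable_compose[OF meas(2)[OF that(2)] gradF_meas]
          measurable_compose[OF meas(3)[OF that(2)] gradF_meas] by auto
      show "sq_integrable M (\<lambda>\<omega>. w n \<omega> - z n \<omega>)" using that by (simp add: reg_def)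
    qed (use F_Lipschitz in auto)
    from sq_integrable_diff[OF gradw_sq[OF that] this] show ?thesis by simp
  qed
  have g_sq: "sq_integrable M (g n)" if "reg n" "n \<ge> 1" for n
    by (rule sq_integrable_dominated[OF meas(5)[OF that(2)]
          sq_integrable_add[OF gradz_sq[OF that] \<delta>_sq[OF that(2)]], of 1])
       (use \<delta>_eq that in auto)

  have reg: "reg n" if "n \<ge> 1" for n
    using that
  proof (induction n rule: nat_induct_at_least)
    case base
    have "sq_integrable M (\<lambda>_. 0 :: real ^ 'd)" by (simp add: sq_integrable_def)
    moreover have "sq_integrable M (\<lambda>\<omega>. w 1 \<omega> - z 1 \<omega>)"
    proof (rule sq_integrable_dominated[OF _ calculation])
      show "(\<lambda>\<omega>. w 1 \<omega> - z 1 \<omega>) \<in> borel_measurable M" using meas(2,3)[of 1] by auto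
      show "AE \<omega> in M. norm (w 1 \<omega> - z 1 \<omega>) \<le> 1 * norm (0 :: real ^ 'd)"
        using z_eq[of 1] \<gamma>_1 by auto
    qed
    ultimately show ?case using init \<mu>_1 by (simp add: reg_def)
  next
    case (Suc n)
    have lamg: "sq_integrable M (\<lambda>\<omega>. lam n \<omega> * g n \<omega>)"
      by (rule sq_integrable_hadamard[OF meas(7) Kl g_sq]) (use Suc in auto)
    \<comment> \<open>\<open>F (w (Suc n))\<close> lies between the lower bound \<open>l\<close> and the descent bound.\<close>
    have "integrable M (\<lambda>\<omega>. F (w (Suc n) \<omega>))"
    proof (rule Bochner_Integration.integrable_bound)
      show "integrable M (\<lambda>\<omega>. \<bar>l\<bar> + \<bar>F (w n \<omega>) - gradF (w n \<omega>) \<bullet> (lam n \<omega> * g n \<omega>)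
          + L / 2 * (norm (lam n \<omega> * g n \<omega>))\<^sup>2\<bar>)"
        using Suc lamg integrable_inner_sq_integrable[OF gradw_sq[OF Suc.IH Suc.hyps] lamg]
        by (auto simp: reg_def dest: sq_integrable_integrable)
      show "(\<lambda>\<omega>. F (w (Suc n) \<omega>)) \<in> borel_measurable M"
        using measurable_compose[OF meas(2) F_meas] by simp
      show "AE \<omega> in M. norm (F (w (Suc n) \<omega>)) \<le> norm (\<bar>l\<bar> + \<bar>F (w n \<omega>)
          - gradF (w n \<omega>) \<bullet> (lam n \<omega> * g n \<omega>) + L / 2 * (norm (lam n \<omega> * g n \<omega>))\<^sup>2\<bar>)"
      proof (rule AE_I2)
        fix \<omega> assume "\<omega> \<in> space M"
        then have "F (w (Suc n) \<omega>) \<le> F (w n \<omega>) - gradF (w n \<omega>) \<bullet> (lam n \<omega> * g n \<omega>)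
            + L / 2 * (norm (lam n \<omega> * g n \<omega>))\<^sup>2"
          using Lipschitz_gradient_descent[OF F_grad F_Lipschitz, of "w n \<omega>" "- (lam n \<omega> * g n \<omega>)"]
            w_eq[OF Suc.hyps] by simp
        with l[of "w (Suc n) \<omega>"] show "norm (F (w (Suc n) \<omega>)) \<le> norm (\<bar>l\<bar> + \<bar>F (w n \<omega>)
          - gradF (w n \<omega>) \<bullet> (lam n \<omega> * g n \<omega>) + L / 2 * (norm (lam n \<omega> * g n \<omega>))\<^sup>2\<bar>)"
          unfolding real_norm_def by linarith
      qed
    qed
    moreover have D: "sq_integrable M (\<lambda>\<omega>. w (Suc n) \<omega> - \<theta> (Suc n) \<omega>)"
    proof (rule sq_integrable_dominated)
      show "sq_integrable M (\<lambda>\<omega>. (1 - \<mu> n) *\<^sub>R (w n \<omega> - \<theta> n \<omega>) - (lam n \<omega> - \<alpha> n \<omega>) * g n \<omega>)"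
        by (intro sq_integrable_diff sq_integrable_hadamard[OF _ Kla g_sq])
           (use Suc meas(7,8)[OF Suc.hyps] in \<open>auto simp: reg_def\<close>)
      show "AE \<omega> in M. norm (w (Suc n) \<omega> - \<theta> (Suc n) \<omega>)
          \<le> 1 * norm ((1 - \<mu> n) *\<^sub>R (w n \<omega> - \<theta> n \<omega>) - (lam n \<omega> - \<alpha> n \<omega>) * g n \<omega>)"
      proof (rule AE_I2)
        fix \<omega> assume "\<omega> \<in> space M"
        then have "w (Suc n) \<omega> - \<theta> (Suc n) \<omega>
            = (1 - \<mu> n) *\<^sub>R (w n \<omega> - \<theta> n \<omega>) - (lam n \<omega> - \<alpha> n \<omega>) * g n \<omega>"
          using w_eq \<theta>_eq y_eq Suc.hyps by (simp add: algebra_simps)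
        then show "norm (w (Suc n) \<omega> - \<theta> (Suc n) \<omega>)
            \<le> 1 * norm ((1 - \<mu> n) *\<^sub>R (w n \<omega> - \<theta> n \<omega>) - (lam n \<omega> - \<alpha> n \<omega>) * g n \<omega>)" by simp
      qed
      show "(\<lambda>\<omega>. w (Suc n) \<omega> - \<theta> (Suc n) \<omega>) \<in> borel_measurable M"
        using meas(1,2)[of "Suc n"] by auto
    qed
    moreover have "sq_integrable M (\<lambda>\<omega>. w (Suc n) \<omega> - z (Suc n) \<omega>)"
    proof (rule sq_integrable_dominated)
      show "sq_integrable M (\<lambda>\<omega>. (1 - \<gamma> (Suc n) \<omega>) * (w (Suc n) \<omega> - \<theta> (Suc n) \<omega>))"
      proof (rule sq_integrable_hadamard[OF _ _ D])
        show "(\<lambda>\<omega>. 1 - \<gamma> (Suc n) \<omega>) \<in> borel_measurable M" using meas(6)[of "Suc n"] by auto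
        show "AE \<omega> in M. norm (1 - \<gamma> (Suc n) \<omega>) \<le> sqrt (B * (1 - \<mu> (Suc n)))"
          using AE_B[of "Suc n"] Suc.hyps by (auto intro: real_le_rsqrt)
      qed
      show "AE \<omega> in M. norm (w (Suc n) \<omega> - z (Suc n) \<omega>)
          \<le> 1 * norm ((1 - \<gamma> (Suc n) \<omega>) * (w (Suc n) \<omega> - \<theta> (Suc n) \<omega>))"
      proof (rule AE_I2)
        fix \<omega> assume "\<omega> \<in> space M"
        then have "w (Suc n) \<omega> - z (Suc n) \<omega> = (1 - \<gamma> (Suc n) \<omega>) * (w (Suc n) \<omega> - \<theta> (Suc n) \<omega>)"
          using z_eq[of "Suc n" \<omega>] by (simp add: vec_eq_iff algebra_simps)
        then show "norm (w (Suc n) \<omega> - z (Suc n) \<omega>)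
            \<le> 1 * norm ((1 - \<gamma> (Suc n) \<omega>) * (w (Suc n) \<omega> - \<theta> (Suc n) \<omega>))" by simp
      qed
      show "(\<lambda>\<omega>. w (Suc n) \<omega> - z (Suc n) \<omega>) \<in> borel_measurable M"
        using meas(2,3)[of "Suc n"] by auto
    qed
    ultimately show ?case by (simp add: reg_def sq_integrable_scaleR)
  qed

  define c where "c n N = (\<Sum>j=n..N. \<Gamma> j) / (\<mu> n * \<Gamma> n)" for n N
  \<comment> \<open>The coefficient of the noise in the energy inequality; it is known at time \<open>n\<close>.\<close>
  define V where "V n N \<omega> = L *\<^sub>R ((lam n \<omega>)\<^sup>2 * gradF (z n \<omega>)) - lam n \<omega> * gradF (w n \<omega>)
      + (L * B * c n N) *\<^sub>R ((lam n \<omega> - \<alpha> n \<omega>)\<^sup>2 * gradF (z n \<omega>))" for n N \<omega>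
  have V_sq: "sq_integrable M (V n N)" and V_mean: "(\<integral>\<omega>. V n N \<omega> \<bullet> \<delta> n \<omega> \<partial>M) = 0"
    if n: "n \<ge> 1" for n N
  proof -
    interpret fin_sub: finite_measure_subalgebra M "Fs n" by (rule sub[OF n])
    note [simp] = reg[OF n]
    have V_alt: "V n N = (\<lambda>\<omega>. L *\<^sub>R (lam n \<omega> * (lam n \<omega> * gradF (z n \<omega>))) - lam n \<omega> * gradF (w n \<omega>)
      + (L * B * c n N) *\<^sub>R ((lam n \<omega> - \<alpha> n \<omega>) * ((lam n \<omega> - \<alpha> n \<omega>) * gradF (z n \<omega>))))"
      by (simp add: V_def power2_eq_square mult.assoc fun_eq_iff)
    have [measurable]: "lam n \<in> borel_measurable (Fs n)" "\<alpha> n \<in> borel_measurable (Fs n)"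
      "(\<lambda>\<omega>. gradF (z n \<omega>)) \<in> borel_measurable (Fs n)" "(\<lambda>\<omega>. gradF (w n \<omega>)) \<in> borel_measurable (Fs n)"
      using adapted n measurable_compose[OF adapted(1)[OF n] gradF_meas]
        measurable_compose[OF adapted(2)[OF n] gradF_meas] by auto
    have V_Fs: "V n N \<in> borel_measurable (Fs n)" unfolding V_alt by measurable
    have lam_M: "lam n \<in> borel_measurable M" and diff_M: "(\<lambda>\<omega>. lam n \<omega> - \<alpha> n \<omega>) \<in> borel_measurable M"
      using meas(7,8)[OF n] by auto
    show sq: "sq_integrable M (V n N)"
      unfolding V_alt
      by (intro sq_integrable_add sq_integrable_diff sq_integrable_scaleR
          sq_integrable_hadamard[OF lam_M Kl[OF n]] sq_integrable_hadamard[OF diff_M Kla[OF n]]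
          gradz_sq gradw_sq) (use n in auto)
    have "(\<integral>\<omega>. V n N \<omega> \<bullet> \<delta> n \<omega> \<partial>M) = (\<integral>\<omega>. V n N \<omega> \<bullet> (g n \<omega> - gradF (z n \<omega>)) \<partial>M)"
      using \<delta>_eq[OF n] by (intro Bochner_Integration.integral_cong) auto
    also have "\<dots> = 0"
      by (rule fin_sub.expectation_inner_unbiased_noise[OF V_Fs sq _ gradz_sq g_sq unbiased]) (use n in auto)
    finally show "(\<integral>\<omega>. V n N \<omega> \<bullet> \<delta> n \<omega> \<partial>M) = 0" .
  qed

  obtain K where K: "\<And>N. \<bar>\<sigma>\<^sup>2 * (\<Sum>n=1..N. R n N)\<bar> \<le> K"
    using convergent_imp_Bseq[OF R_sum] by (auto simp: Bseq_def)
  have weighted: "(\<Sum>n=1..N. \<integral>\<omega>. m n * (norm (gradF (z n \<omega>)))\<^sup>2 \<partial>M)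
      \<le> (\<integral>\<omega>. F (w 1 \<omega>) \<partial>M) + L / 2 * K - l" for N
  proof -
    have "AE \<omega> in M. \<forall>n\<in>{1..N}. vec (m n) \<le> lam n \<omega> - L *\<^sub>R (lam n \<omega>)\<^sup>2
            - (L * B / 2 * c n N) *\<^sub>R (lam n \<omega> - \<alpha> n \<omega>)\<^sup>2"
      using step_lower C_eq by (intro AE_finite_allI) (auto simp: c_def)
    moreover have "AE \<omega> in M. \<forall>n\<in>{1..N}. (norm (lam n \<omega>))\<^sup>2
            + B * c n N * (norm (lam n \<omega> - \<alpha> n \<omega>))\<^sup>2 \<le> R n N"
      using step_upper C_eq by (intro AE_finite_allI) (auto simp: c_def)
    moreover have "AE \<omega> in M. \<forall>n\<in>{2..}. (norm (1 - \<gamma> n \<omega>))\<^sup>2 \<le> B * (1 - \<mu> n)"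
      using AE_B by (intro AE_ball_countable[THEN iffD2]) auto
    ultimately have path: "AE \<omega> in M. l + (\<Sum>n=1..N. m n * (norm (gradF (z n \<omega>)))\<^sup>2)
      \<le> F (w 1 \<omega>) + (\<Sum>n=1..N. L / 2 * R n N * (norm (\<delta> n \<omega>))\<^sup>2) + (\<Sum>n=1..N. V n N \<omega> \<bullet> \<delta> n \<omega>)"
      using AE_space
    proof eventually_elim
      case (elim \<omega>)
      have "F (w (Suc N) \<omega>) + (\<Sum>n=1..N. m n * (norm (gradF (z n \<omega>)))\<^sup>2)
        \<le> F (w 1 \<omega>) + (\<Sum>n=1..N. L / 2 * R n N * (norm (g n \<omega> - gradF (z n \<omega>)))\<^sup>2)
          + (\<Sum>n=1..N. V n N \<omega> \<bullet> (g n \<omega> - gradF (z n \<omega>)))"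
        unfolding V_def c_def
        by (rule energy_inequality[where \<theta> = "\<lambda>n. \<theta> n \<omega>" and \<gamma> = "\<lambda>n. \<gamma> n \<omega>" and w = "\<lambda>n. w n \<omega>"
              and z = "\<lambda>n. z n \<omega>" and lam = "\<lambda>n. lam n \<omega>" and \<alpha> = "\<lambda>n. \<alpha> n \<omega>" and g = "\<lambda>n. g n \<omega>"
              and R = "\<lambda>n. R n N",
              OF F_grad F_Lipschitz less_imp_le[OF L_pos] _ _ _ \<mu>_1 \<mu> \<Gamma>pos \<Gamma>_1 \<Gamma>rec _ _ \<open>0 \<le> B\<close>])
           (use elim z_eq w_eq \<theta>_eq y_eq \<gamma>_1 in \<open>auto simp: c_def\<close>)
      also have "(\<Sum>n=1..N. L / 2 * R n N * (norm (g n \<omega> - gradF (z n \<omega>)))\<^sup>2)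
          = (\<Sum>n=1..N. L / 2 * R n N * (norm (\<delta> n \<omega>))\<^sup>2)"
        using \<delta>_eq elim by (intro sum.cong) auto
      also have "(\<Sum>n=1..N. V n N \<omega> \<bullet> (g n \<omega> - gradF (z n \<omega>))) = (\<Sum>n=1..N. V n N \<omega> \<bullet> \<delta> n \<omega>)"
        using \<delta>_eq elim by (intro sum.cong) auto
      finally show ?case using l[of "w (Suc N) \<omega>"] by simp
    qed
    have int_G: "integrable M (\<lambda>\<omega>. m n * (norm (gradF (z n \<omega>)))\<^sup>2)"
      and int_\<delta>: "integrable M (\<lambda>\<omega>. L / 2 * R n N * (norm (\<delta> n \<omega>))\<^sup>2)"
      and int_V: "integrable M (\<lambda>\<omega>. V n N \<omega> \<bullet> \<delta> n \<omega>)" if "n \<in> {1..N}" for n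
      using that gradz_sq[OF reg, of n] \<delta>_sq[of n] integrable_inner_sq_integrable[OF V_sq \<delta>_sq, of n n N]
      by (auto dest!: sq_integrable_integrable)
    have "l + (\<Sum>n=1..N. \<integral>\<omega>. m n * (norm (gradF (z n \<omega>)))\<^sup>2 \<partial>M)
        = (\<integral>\<omega>. l + (\<Sum>n=1..N. m n * (norm (gradF (z n \<omega>)))\<^sup>2) \<partial>M)"
    proof -
      have "integrable M (\<lambda>\<omega>. \<Sum>n=1..N. m n * (norm (gradF (z n \<omega>)))\<^sup>2)"
        by (rule Bochner_Integration.integrable_sum) (rule int_G)
      moreover have "(\<integral>\<omega>. (\<Sum>n=1..N. m n * (norm (gradF (z n \<omega>)))\<^sup>2) \<partial>M)
          = (\<Sum>n=1..N. \<integral>\<omega>. m n * (norm (gradF (z n \<omega>)))\<^sup>2 \<partial>M)"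
        by (rule Bochner_Integration.integral_sum) (rule int_G)
      moreover have "(\<integral>\<omega>. l \<partial>M) = l" by (simp add: prob_space)
      ultimately show ?thesis
        by (subst Bochner_Integration.integral_add) (simp_all only: integrable_const)
    qed
    also have "\<dots> \<le> (\<integral>\<omega>. F (w 1 \<omega>) + (\<Sum>n=1..N. L / 2 * R n N * (norm (\<delta> n \<omega>))\<^sup>2)
        + (\<Sum>n=1..N. V n N \<omega> \<bullet> \<delta> n \<omega>) \<partial>M)"
      using init int_G int_\<delta> int_V
      by (intro integral_mono_AE path Bochner_Integration.integrable_add Bochner_Integration.integrable_sum) auto
    also have "\<dots> = (\<integral>\<omega>. F (w 1 \<omega>) \<partial>M)
        + (\<Sum>n=1..N. \<integral>\<omega>. L / 2 * R n N * (norm (\<delta> n \<omega>))\<^sup>2 \<partial>M) + (\<Sum>n=1..N. \<integral>\<omega>. V n N \<omega> \<bullet> \<delta> n \<omega> \<partial>M)"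
      using init int_\<delta> int_V
      by (simp only: Bochner_Integration.integral_add Bochner_Integration.integral_sum
          Bochner_Integration.integrable_add Bochner_Integration.integrable_sum)
    also have "(\<Sum>n=1..N. \<integral>\<omega>. V n N \<omega> \<bullet> \<delta> n \<omega> \<partial>M) = 0"
      using V_mean by (intro sum.neutral) auto
    also have "(\<Sum>n=1..N. \<integral>\<omega>. L / 2 * R n N * (norm (\<delta> n \<omega>))\<^sup>2 \<partial>M) \<le> (\<Sum>n=1..N. L / 2 * R n N * \<sigma>\<^sup>2)"
    proof (rule sum_mono)
      fix n assume "n \<in> {1..N}"
      then show "(\<integral>\<omega>. L / 2 * R n N * (norm (\<delta> n \<omega>))\<^sup>2 \<partial>M) \<le> L / 2 * R n N * \<sigma>\<^sup>2"
        using L_pos R_pos[of n N] \<delta>_var[of n] by simp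
    qed
    also have "(\<Sum>n=1..N. L / 2 * R n N * \<sigma>\<^sup>2) = L / 2 * (\<sigma>\<^sup>2 * (\<Sum>n=1..N. R n N))"
      unfolding sum_distrib_left by (intro sum.cong) auto
    also have "\<dots> \<le> L / 2 * K"
      using K[of N] L_pos by (intro mult_left_mono) auto
    finally show ?thesis by simp
  qed

  have "AE \<omega> in M. \<exists>K'. \<forall>N. (\<Sum>n=1..N. m n * (norm (gradF (z n \<omega>)))\<^sup>2) \<le> K'"
  proof (rule AE_bounded_partial_sums[OF _ _ weighted])
    show "integrable M (\<lambda>\<omega>. m n * (norm (gradF (z n \<omega>)))\<^sup>2)" if "n \<ge> 1" for n
      using sq_integrable_integrable[OF gradz_sq[OF reg[OF that] that]] by simp
    show "0 \<le> m n * (norm (gradF (z n \<omega>)))\<^sup>2" if "n \<ge> 1" for n \<omega>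
      using m_pos[OF that] by simp
  qed
  then show ?thesis
  proof eventually_elim
    case (elim \<omega>)
    then obtain K' where "\<And>N. (\<Sum>n=1..N. m n * (norm (gradF (z n \<omega>)))\<^sup>2) \<le> K'" by blast
    then show ?case by (intro liminf_zero_of_weighted_square_sums[OF _ m_pos _ m_sum]) auto
  qed
qed

end
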